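(* Let $A$ be a finite-dimensional complex algebra with center $Z(A)$, let $I\subseteq Z(A)$ be a cube with its measure $\mu$, and let $\mathrm{ACI}(A)\subseteq A$ be the set of average central integrals of $A$. Consider the correspondence \[ c\longmapsto \frac{1}{\mu(I)}\int_{I} c\,\mathbf{1}_{I}\,d\mu \qquad (c\in Z(A)), \] where $c\,\mathbf 1_I$ is the constant function $I\to A$ with value $c$. Then: (1) This correspondence is a bijection from $Z(A)$ onto $\mathrm{ACI}(A)$; furthermore it is an isomorphism of $\mathbb{C}$-algebras. (2) Each $u\in \mathrm{ACI}(A)$ induces a natural transformation from the identity functor of $A\text{-}\mathrm{mod}$ to itself, whose component at $M$ is $\rho_M(u):M\to M$, $m\mapsto u.m$. (3) For each $u\in\mathrm{ACI}(A)$, the natural transformation of (2) lifts to a natural transformation from the identity functor of the bounded derived category $D^b(A)$ to itself, whose component at a bounded complex $X^\bullet=(X^m,d_X^m)_{m\in\mathbb{Z}}$ is the endomorphism given in degree $m$ by $x^m\mapsto u.x^m$.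
   Context: Algebras are associative and unital over $\mathbb{C}$; $A\text{-}\mathrm{mod}$ is the category of finite-dimensional left $A$-modules and $D^b(A)$ is its bounded derived category. For a left $A$-module $M$, $\rho_M:A\to \mathrm{End}_{\mathbb{C}}(M)$ is the structure homomorphism $a\mapsto(m\mapsto a.m)$. Cube in the center: fix a $\mathbb{C}$-basis $z_1,\dots,z_k$ of $Z(A)$ and reals $r<s$, and put $I=\{\sum_i\lambda_i z_i:\lambda_i\in[r,s]\}$, in bijection with $[r,s]^k$, with measure $\mu$ transported from $k$-dimensional Lebesgue measure (so $0<\mu(I)<\infty$). $A$ carries any norm (all are equivalent), $L^1(I;A)$ is the space of Bochner integrable functions $I\to A$, and $\int$ denotes the Bochner integral. A function $f\in L^1(I;A)$ satisfies the central condition if $f(x)\in Z(A)$ for almost every $x\in I$. The average central integrals of $A$ are the elements $\frac{1}{\mu(J)}\int_{I}\mathbf{1}_J f\,d\mu\in A$ with $f\in L^1(I;A)$ satisfying the central condition and $J\subseteq I$ measurable with $\mu(J)>0$; $\mathrm{ACI}(A)\subseteq A$ is the set of all of them, with the operations of $A$. *)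

theory Defs
  imports "HOL-Analysis.Analysis" "HOL-Algebra.Module" "HOL-Algebra.AbelCoset"
begin

section \<open>Finite-dimensional complex algebras\<close>

text \<open>The sort \<open>{ring, monoid_mult}\<close> gives unital rings without excluding the zero ring (which
  \<open>ring_1\<close> would do).  The norm is an arbitrary norm of complex vector spaces; it is not assumed to
  be submultiplicative.  The classes \<open>banach\<close> and \<open>second_countable_topology\<close>, which the Bochner
  integral needs, are no restriction in finite dimension.\<close>

class fd_complex_algebra = ring + monoid_mult + banach + second_countable_topology +
  fixes scaleC :: "complex \<Rightarrow> 'a \<Rightarrow> 'a" (infixr "*\<^sub>C" 75)
  assumes scaleC_add_right: "c *\<^sub>C (x + y) = c *\<^sub>C x + c *\<^sub>C y"
    and scaleC_add_left: "(c + d) *\<^sub>C x = c *\<^sub>C x + d *\<^sub>C x"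
    and scaleC_scaleC: "c *\<^sub>C d *\<^sub>C x = (c * d) *\<^sub>C x"
    and scaleC_one: "1 *\<^sub>C x = x"
    and scaleR_scaleC: "t *\<^sub>R x = complex_of_real t *\<^sub>C x"
    and norm_scaleC: "norm (c *\<^sub>C x) = cmod c * norm x"
    and mult_scaleC_left: "(c *\<^sub>C x) * y = c *\<^sub>C (x * y)"
    and mult_scaleC_right: "x * (c *\<^sub>C y) = c *\<^sub>C (x * y)"
    and finite_dimensional: "\<exists>B. finite B \<and> (\<forall>x. \<exists>c. x = (\<Sum>b\<in>B. c b *\<^sub>C b))"

definition center :: "'a::fd_complex_algebra set"
  where "center = {z. \<forall>a. z * a = a * z}"

definition subalgebra :: "'a::fd_complex_algebra set \<Rightarrow> bool"
  where "subalgebra S \<longleftrightarrow> 0 \<in> S \<and> 1 \<in> S \<and>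
    (\<forall>x\<in>S. \<forall>y\<in>S. x + y \<in> S \<and> x * y \<in> S) \<and> (\<forall>c. \<forall>x\<in>S. c *\<^sub>C x \<in> S)"

definition algebra_iso_on :: "'a::fd_complex_algebra set \<Rightarrow> 'b::fd_complex_algebra set \<Rightarrow> ('a \<Rightarrow> 'b) \<Rightarrow> bool"
  where "algebra_iso_on S T f \<longleftrightarrow> subalgebra S \<and> subalgebra T \<and> bij_betw f S T \<and> f 1 = 1 \<and>
    (\<forall>x\<in>S. \<forall>y\<in>S. f (x + y) = f x + f y \<and> f (x * y) = f x * f y) \<and>
    (\<forall>c. \<forall>x\<in>S. f (c *\<^sub>C x) = c *\<^sub>C f x)"


section \<open>Cubes in the center and average central integrals\<close>

definition center_basis :: "nat \<Rightarrow> (nat \<Rightarrow> 'a::fd_complex_algebra) \<Rightarrow> bool"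
  where "center_basis k z \<longleftrightarrow>
    (\<forall>c. (\<Sum>i<k. c i *\<^sub>C z i) = 0 \<longrightarrow> (\<forall>i<k. c i = 0)) \<and>
    range (\<lambda>c. \<Sum>i<k. c i *\<^sub>C z i) = center"

definition cube_param :: "nat \<Rightarrow> (nat \<Rightarrow> 'a::fd_complex_algebra) \<Rightarrow> (nat \<Rightarrow> real) \<Rightarrow> 'a"
  where "cube_param k z l = (\<Sum>i<k. complex_of_real (l i) *\<^sub>C z i)"

definition cube :: "nat \<Rightarrow> (nat \<Rightarrow> 'a::fd_complex_algebra) \<Rightarrow> real \<Rightarrow> real \<Rightarrow> 'a set"
  where "cube k z r s = cube_param k z ` ({..<k} \<rightarrow>\<^sub>E {r..s})"

text \<open>Completing the product measure makes its measurable sets the Lebesgue measurable ones.\<close>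

definition cube_measure :: "nat \<Rightarrow> (nat \<Rightarrow> 'a::fd_complex_algebra) \<Rightarrow> real \<Rightarrow> real \<Rightarrow> 'a measure"
  where "cube_measure k z r s =
    embed_measure
      (restrict_space (completion (PiM {..<k} (\<lambda>_. lborel))) ({..<k} \<rightarrow>\<^sub>E {r..s}))
      (cube_param k z)"

definition central_condition :: "'a::fd_complex_algebra measure \<Rightarrow> ('a \<Rightarrow> 'a) \<Rightarrow> bool"
  where "central_condition \<mu> f \<longleftrightarrow> (AE x in \<mu>. f x \<in> center)"

definition average :: "'a::fd_complex_algebra measure \<Rightarrow> 'a set \<Rightarrow> ('a \<Rightarrow> 'a) \<Rightarrow> 'a"
  where "average \<mu> J f = (1 / measure \<mu> J) *\<^sub>R (LINT x:J|\<mu>. f x)"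

definition ACI :: "'a::fd_complex_algebra measure \<Rightarrow> 'a set"
  where "ACI \<mu> = {average \<mu> J f | J f.
    integrable \<mu> f \<and> central_condition \<mu> f \<and> J \<in> sets \<mu> \<and> measure \<mu> J > 0}"


section \<open>Categories, functors and natural transformations\<close>

text \<open>\<open>Comp C X Y Z g f\<close> is the composite of \<open>f : X \<rightarrow> Y\<close> and \<open>g : Y \<rightarrow> Z\<close>.\<close>

record ('o, 'f) category =
  Obj :: "'o set"
  Hom :: "'o \<Rightarrow> 'o \<Rightarrow> 'f set"
  Ident :: "'o \<Rightarrow> 'f"
  Comp :: "'o \<Rightarrow> 'o \<Rightarrow> 'o \<Rightarrow> 'f \<Rightarrow> 'f \<Rightarrow> 'f"

definition is_category :: "('o, 'f) category \<Rightarrow> bool"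
  where "is_category C \<longleftrightarrow>
    (\<forall>X\<in>Obj C. Ident C X \<in> Hom C X X) \<and>
    (\<forall>X\<in>Obj C. \<forall>Y\<in>Obj C. \<forall>Z\<in>Obj C. \<forall>f\<in>Hom C X Y. \<forall>g\<in>Hom C Y Z. Comp C X Y Z g f \<in> Hom C X Z) \<and>
    (\<forall>X\<in>Obj C. \<forall>Y\<in>Obj C. \<forall>f\<in>Hom C X Y.
        Comp C X X Y f (Ident C X) = f \<and> Comp C X Y Y (Ident C Y) f = f) \<and>
    (\<forall>W\<in>Obj C. \<forall>X\<in>Obj C. \<forall>Y\<in>Obj C. \<forall>Z\<in>Obj C.
      \<forall>f\<in>Hom C W X. \<forall>g\<in>Hom C X Y. \<forall>h\<in>Hom C Y Z.
        Comp C W X Z (Comp C X Y Z h g) f = Comp C W Y Z h (Comp C W X Y g f))"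

record ('o, 'f, 'p, 'g) functor_data =
  fobj :: "'o \<Rightarrow> 'p"
  fmap :: "'o \<Rightarrow> 'o \<Rightarrow> 'f \<Rightarrow> 'g"

definition is_functor ::
    "('o, 'f) category \<Rightarrow> ('p, 'g) category \<Rightarrow> ('o, 'f, 'p, 'g) functor_data \<Rightarrow> bool"
  where "is_functor C D F \<longleftrightarrow> is_category C \<and> is_category D \<and>
    (\<forall>X\<in>Obj C. fobj F X \<in> Obj D) \<and>
    (\<forall>X\<in>Obj C. \<forall>Y\<in>Obj C. \<forall>f\<in>Hom C X Y. fmap F X Y f \<in> Hom D (fobj F X) (fobj F Y)) \<and>
    (\<forall>X\<in>Obj C. fmap F X X (Ident C X) = Ident D (fobj F X)) \<and>
    (\<forall>X\<in>Obj C. \<forall>Y\<in>Obj C. \<forall>Z\<in>Obj C. \<forall>f\<in>Hom C X Y. \<forall>g\<in>Hom C Y Z.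
        fmap F X Z (Comp C X Y Z g f) =
        Comp D (fobj F X) (fobj F Y) (fobj F Z) (fmap F Y Z g) (fmap F X Y f))"

definition identity_functor :: "('o, 'f, 'o, 'f) functor_data"
  where "identity_functor = \<lparr>fobj = (\<lambda>X. X), fmap = (\<lambda>X Y f. f)\<rparr>"

definition comp_functor ::
    "('p, 'g, 'q, 'h) functor_data \<Rightarrow> ('o, 'f, 'p, 'g) functor_data \<Rightarrow> ('o, 'f, 'q, 'h) functor_data"
  where "comp_functor G F =
    \<lparr>fobj = (\<lambda>X. fobj G (fobj F X)),
     fmap = (\<lambda>X Y f. fmap G (fobj F X) (fobj F Y) (fmap F X Y f))\<rparr>"

definition natural_transformation ::
    "('o, 'f) category \<Rightarrow> ('p, 'g) category \<Rightarrow> ('o, 'f, 'p, 'g) functor_data \<Rightarrow>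
     ('o, 'f, 'p, 'g) functor_data \<Rightarrow> ('o \<Rightarrow> 'g) \<Rightarrow> bool"
  where "natural_transformation C D F G \<eta> \<longleftrightarrow> is_functor C D F \<and> is_functor C D G \<and>
    (\<forall>X\<in>Obj C. \<eta> X \<in> Hom D (fobj F X) (fobj G X)) \<and>
    (\<forall>X\<in>Obj C. \<forall>Y\<in>Obj C. \<forall>f\<in>Hom C X Y.
        Comp D (fobj F X) (fobj F Y) (fobj G Y) (\<eta> Y) (fmap F X Y f) =
        Comp D (fobj F X) (fobj G X) (fobj G Y) (fmap G X Y f) (\<eta> X))"

text \<open>An endotransformation \<open>\<theta>\<close> of the identity of \<open>D\<close> lifts an endotransformation \<open>\<eta>\<close> of the identity
  of \<open>C\<close> along \<open>E : C \<rightarrow> D\<close>.\<close>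

definition lifts_along ::
    "('o, 'f) category \<Rightarrow> ('p, 'g) category \<Rightarrow> ('o, 'f, 'p, 'g) functor_data \<Rightarrow>
     ('o \<Rightarrow> 'f) \<Rightarrow> ('p \<Rightarrow> 'g) \<Rightarrow> bool"
  where "lifts_along C D E \<eta> \<theta> \<longleftrightarrow> is_functor C D E \<and>
    (\<forall>X\<in>Obj C. \<theta> (fobj E X) = fmap E X X (\<eta> X))"


section \<open>Localization of a category\<close>

text \<open>The localization of \<open>C\<close> at a class \<open>W\<close> of morphisms is the category of zigzags modulo the
  relations that make \<open>C \<rightarrow> C[W\<^sup>-\<^sup>1]\<close> a functor inverting \<open>W\<close>.  The steps \<open>Fwd X f Y\<close> and
  \<open>Bwd X s Y\<close> both lead from \<open>X\<close> to \<open>Y\<close>: the first is \<open>f : X \<rightarrow> Y\<close>, the second the formal inverse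
  of \<open>s : Y \<rightarrow> X\<close> in \<open>W\<close>.  Zigzags are listed in the order in which they are travelled, that is, in
  the order opposite to composition.\<close>

datatype ('o, 'f) zigzag_step = Fwd 'o 'f 'o | Bwd 'o 'f 'o

inductive zigzag ::
    "('o, 'f) category \<Rightarrow> ('o \<Rightarrow> 'o \<Rightarrow> 'f \<Rightarrow> bool) \<Rightarrow> 'o \<Rightarrow> ('o, 'f) zigzag_step list \<Rightarrow> 'o \<Rightarrow> bool"
  for C W where
    zigzag_Nil: "X \<in> Obj C \<Longrightarrow> zigzag C W X [] X"
  | zigzag_Fwd: "\<lbrakk>X \<in> Obj C; Y \<in> Obj C; f \<in> Hom C X Y; zigzag C W Y p Z\<rbrakk>
      \<Longrightarrow> zigzag C W X (Fwd X f Y # p) Z"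
  | zigzag_Bwd: "\<lbrakk>X \<in> Obj C; Y \<in> Obj C; s \<in> Hom C Y X; W Y X s; zigzag C W Y p Z\<rbrakk>
      \<Longrightarrow> zigzag C W X (Bwd X s Y # p) Z"

inductive zigzag_eq ::
    "('o, 'f) category \<Rightarrow> ('o \<Rightarrow> 'o \<Rightarrow> 'f \<Rightarrow> bool) \<Rightarrow> 'o \<Rightarrow> 'o \<Rightarrow>
     ('o, 'f) zigzag_step list \<Rightarrow> ('o, 'f) zigzag_step list \<Rightarrow> bool"
  for C W where
    zz_refl: "zigzag C W X p Y \<Longrightarrow> zigzag_eq C W X Y p p"
  | zz_sym: "zigzag_eq C W X Y p q \<Longrightarrow> zigzag_eq C W X Y q p"
  | zz_trans: "\<lbrakk>zigzag_eq C W X Y p q; zigzag_eq C W X Y q r\<rbrakk> \<Longrightarrow> zigzag_eq C W X Y p r"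
  | zz_append: "\<lbrakk>zigzag_eq C W X Y p p'; zigzag_eq C W Y Z q q'\<rbrakk>
      \<Longrightarrow> zigzag_eq C W X Z (p @ q) (p' @ q')"
  | zz_ident: "X \<in> Obj C \<Longrightarrow> zigzag_eq C W X X [Fwd X (Ident C X) X] []"
  | zz_comp: "\<lbrakk>X \<in> Obj C; Y \<in> Obj C; Z \<in> Obj C; f \<in> Hom C X Y; g \<in> Hom C Y Z\<rbrakk>
      \<Longrightarrow> zigzag_eq C W X Z [Fwd X f Y, Fwd Y g Z] [Fwd X (Comp C X Y Z g f) Z]"
  | zz_inv_right: "\<lbrakk>X \<in> Obj C; Y \<in> Obj C; s \<in> Hom C X Y; W X Y s\<rbrakk>
      \<Longrightarrow> zigzag_eq C W X X [Fwd X s Y, Bwd Y s X] []"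
  | zz_inv_left: "\<lbrakk>X \<in> Obj C; Y \<in> Obj C; s \<in> Hom C X Y; W X Y s\<rbrakk>
      \<Longrightarrow> zigzag_eq C W Y Y [Bwd Y s X, Fwd X s Y] []"

definition zigzag_class ::
    "('o, 'f) category \<Rightarrow> ('o \<Rightarrow> 'o \<Rightarrow> 'f \<Rightarrow> bool) \<Rightarrow> 'o \<Rightarrow> 'o \<Rightarrow>
     ('o, 'f) zigzag_step list \<Rightarrow> ('o, 'f) zigzag_step list set"
  where "zigzag_class C W X Y p = {q. zigzag_eq C W X Y p q}"

definition localization ::
    "('o, 'f) category \<Rightarrow> ('o \<Rightarrow> 'o \<Rightarrow> 'f \<Rightarrow> bool) \<Rightarrow> ('o, ('o, 'f) zigzag_step list set) category"
  where "localization C W =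
    \<lparr>Obj = Obj C,
     Hom = (\<lambda>X Y. {zigzag_class C W X Y p | p. zigzag C W X p Y}),
     Ident = (\<lambda>X. zigzag_class C W X X []),
     Comp = (\<lambda>X Y Z G F. \<Union>f\<in>F. \<Union>g\<in>G. zigzag_class C W X Z (f @ g))\<rparr>"

definition localization_functor ::
    "('o, 'f) category \<Rightarrow> ('o \<Rightarrow> 'o \<Rightarrow> 'f \<Rightarrow> bool) \<Rightarrow>
     ('o, 'f, 'o, ('o, 'f) zigzag_step list set) functor_data"
  where "localization_functor C W =
    \<lparr>fobj = (\<lambda>X. X), fmap = (\<lambda>X Y f. zigzag_class C W X Y [Fwd X f Y])\<rparr>"


section \<open>Finite-dimensional left modules\<close>

text \<open>Modules are carried by subsets of a type \<open>'m\<close>; the fields \<open>mult\<close> and \<open>one\<close> of the record are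
  not used.  A complex number \<open>c\<close> acts on an \<open>A\<close>-module through \<open>c *\<^sub>C 1\<close>.  Homomorphisms are
  undefined outside the carrier, so that equality of morphisms is equality of functions.\<close>

locale left_module = abelian_group M
  for M :: "('a::fd_complex_algebra, 'm) module" (structure) +
  assumes smult_closed: "x \<in> carrier M \<Longrightarrow> a \<odot> x \<in> carrier M"
    and smult_add_left: "x \<in> carrier M \<Longrightarrow> (a + b) \<odot> x = a \<odot> x \<oplus> b \<odot> x"
    and smult_add_right: "\<lbrakk>x \<in> carrier M; y \<in> carrier M\<rbrakk> \<Longrightarrow> a \<odot> (x \<oplus> y) = a \<odot> x \<oplus> a \<odot> y"
    and smult_smult: "x \<in> carrier M \<Longrightarrow> (a * b) \<odot> x = a \<odot> (b \<odot> x)"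
    and smult_unit: "x \<in> carrier M \<Longrightarrow> 1 \<odot> x = x"

definition fd_left_module :: "('a::fd_complex_algebra, 'm) module \<Rightarrow> bool"
  where "fd_left_module M \<longleftrightarrow> left_module M \<and>
    (\<exists>B. finite B \<and> B \<subseteq> carrier M \<and>
      (\<forall>x\<in>carrier M. \<exists>c. x = (\<Oplus>\<^bsub>M\<^esub>b\<in>B. (c b *\<^sub>C 1) \<odot>\<^bsub>M\<^esub> b)))"

definition left_module_hom ::
    "('a::fd_complex_algebra, 'm) module \<Rightarrow> ('a, 'n) module \<Rightarrow> ('m \<Rightarrow> 'n) set"
  where "left_module_hom M N = {f \<in> carrier M \<rightarrow>\<^sub>E carrier N.
    (\<forall>x\<in>carrier M. \<forall>y\<in>carrier M. f (x \<oplus>\<^bsub>M\<^esub> y) = f x \<oplus>\<^bsub>N\<^esub> f y) \<and>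
    (\<forall>a. \<forall>x\<in>carrier M. f (a \<odot>\<^bsub>M\<^esub> x) = a \<odot>\<^bsub>N\<^esub> f x)}"

definition left_module_iso ::
    "('a::fd_complex_algebra, 'm) module \<Rightarrow> ('a, 'n) module \<Rightarrow> ('m \<Rightarrow> 'n) set"
  where "left_module_iso M N = {f \<in> left_module_hom M N. bij_betw f (carrier M) (carrier N)}"

definition fd_modules :: "(('a::fd_complex_algebra, 'm) module, 'm \<Rightarrow> 'm) category"
  where "fd_modules =
    \<lparr>Obj = {M. fd_left_module M},
     Hom = left_module_hom,
     Ident = (\<lambda>M. \<lambda>x\<in>carrier M. x),
     Comp = (\<lambda>L M N g f. compose (carrier L) g f)\<rparr>"

definition structure_hom :: "('a::fd_complex_algebra, 'm) module \<Rightarrow> 'a \<Rightarrow> 'm \<Rightarrow> 'm"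
  where "structure_hom M a = (\<lambda>x\<in>carrier M. a \<odot>\<^bsub>M\<^esub> x)"


section \<open>The bounded derived category\<close>

record ('a, 'm) cochain_complex =
  cterm :: "int \<Rightarrow> ('a, 'm) module"
  cdiff :: "int \<Rightarrow> 'm \<Rightarrow> 'm"

definition bounded_complex :: "('a::fd_complex_algebra, 'm) cochain_complex \<Rightarrow> bool"
  where "bounded_complex X \<longleftrightarrow>
    (\<forall>m. fd_left_module (cterm X m)) \<and>
    (\<forall>m. cdiff X m \<in> left_module_hom (cterm X m) (cterm X (m + 1))) \<and>
    (\<forall>m. \<forall>x\<in>carrier (cterm X m). cdiff X (m + 1) (cdiff X m x) = \<zero>\<^bsub>cterm X (m + 1 + 1)\<^esub>) \<and>
    (\<exists>n. \<forall>m. \<bar>m\<bar> > n \<longrightarrow> carrier (cterm X m) = {\<zero>\<^bsub>cterm X m\<^esub>})"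

definition chain_map ::
    "('a::fd_complex_algebra, 'm) cochain_complex \<Rightarrow> ('a, 'm) cochain_complex \<Rightarrow> (int \<Rightarrow> 'm \<Rightarrow> 'm) set"
  where "chain_map X Y = {f. (\<forall>m. f m \<in> left_module_hom (cterm X m) (cterm Y m)) \<and>
    (\<forall>m. \<forall>x\<in>carrier (cterm X m). f (m + 1) (cdiff X m x) = cdiff Y m (f m x))}"

definition bounded_complexes ::
    "(('a::fd_complex_algebra, 'm) cochain_complex, int \<Rightarrow> 'm \<Rightarrow> 'm) category"
  where "bounded_complexes =
    \<lparr>Obj = {X. bounded_complex X},
     Hom = chain_map,
     Ident = (\<lambda>X m. \<lambda>x\<in>carrier (cterm X m). x),
     Comp = (\<lambda>X Y Z g f m. compose (carrier (cterm X m)) (g m) (f m))\<rparr>"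

definition cycles :: "('a::fd_complex_algebra, 'm) cochain_complex \<Rightarrow> int \<Rightarrow> 'm set"
  where "cycles X m = {x \<in> carrier (cterm X m). cdiff X m x = \<zero>\<^bsub>cterm X (m + 1)\<^esub>}"

definition boundaries :: "('a::fd_complex_algebra, 'm) cochain_complex \<Rightarrow> int \<Rightarrow> 'm set"
  where "boundaries X m = cdiff X (m - 1) ` carrier (cterm X (m - 1))"

definition cohomology ::
    "('a::fd_complex_algebra, 'm) cochain_complex \<Rightarrow> int \<Rightarrow> ('a, 'm set) module"
  where "cohomology X m =
    \<lparr>carrier = (\<lambda>x. boundaries X m +>\<^bsub>cterm X m\<^esub> x) ` cycles X m,
     mult = undefined, one = undefined,
     zero = boundaries X m,
     add = (\<lambda>S T. S <+>\<^bsub>cterm X m\<^esub> T),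
     smult = (\<lambda>a S. \<Union>x\<in>S. boundaries X m +>\<^bsub>cterm X m\<^esub> (a \<odot>\<^bsub>cterm X m\<^esub> x))\<rparr>"

definition cohomology_map ::
    "('a::fd_complex_algebra, 'm) cochain_complex \<Rightarrow> ('a, 'm) cochain_complex \<Rightarrow>
     (int \<Rightarrow> 'm \<Rightarrow> 'm) \<Rightarrow> int \<Rightarrow> 'm set \<Rightarrow> 'm set"
  where "cohomology_map X Y f m =
    (\<lambda>S\<in>carrier (cohomology X m). \<Union>x\<in>S. boundaries Y m +>\<^bsub>cterm Y m\<^esub> f m x)"

definition quasi_isomorphism ::
    "('a::fd_complex_algebra, 'm) cochain_complex \<Rightarrow> ('a, 'm) cochain_complex \<Rightarrow>
     (int \<Rightarrow> 'm \<Rightarrow> 'm) \<Rightarrow> bool"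
  where "quasi_isomorphism X Y f \<longleftrightarrow> f \<in> chain_map X Y \<and>
    (\<forall>m. cohomology_map X Y f m \<in> left_module_iso (cohomology X m) (cohomology Y m))"

type_synonym ('a, 'm) derived_morphism =
  "(('a, 'm) cochain_complex, int \<Rightarrow> 'm \<Rightarrow> 'm) zigzag_step list set"

text \<open>Homotopic chain maps become equal once quasi-isomorphisms are inverted, so there is no need
  to pass to the homotopy category first.\<close>

definition bounded_derived ::
    "(('a::fd_complex_algebra, 'm) cochain_complex, ('a, 'm) derived_morphism) category"
  where "bounded_derived = localization bounded_complexes quasi_isomorphism"

definition to_derived ::
    "(('a::fd_complex_algebra, 'm) cochain_complex, int \<Rightarrow> 'm \<Rightarrow> 'm,
      ('a, 'm) cochain_complex, ('a, 'm) derived_morphism) functor_data"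
  where "to_derived = localization_functor bounded_complexes quasi_isomorphism"

text \<open>The embedding of modules as complexes concentrated in degree \<open>0\<close>.  The other degrees hold the
  zero submodule, so that no further element of \<open>'m\<close> has to be chosen.\<close>

definition stalk_complex :: "('a::fd_complex_algebra, 'm) module \<Rightarrow> ('a, 'm) cochain_complex"
  where "stalk_complex M =
    (let Z = M\<lparr>carrier := {\<zero>\<^bsub>M\<^esub>}\<rparr> in
     \<lparr>cterm = (\<lambda>m. if m = 0 then M else Z),
      cdiff = (\<lambda>m. \<lambda>x\<in>carrier (if m = 0 then M else Z). \<zero>\<^bsub>M\<^esub>)\<rparr>)"

definition stalk_functor ::
    "(('a::fd_complex_algebra, 'm) module, 'm \<Rightarrow> 'm,
      ('a, 'm) cochain_complex, int \<Rightarrow> 'm \<Rightarrow> 'm) functor_data"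
  where "stalk_functor =
    \<lparr>fobj = stalk_complex,
     fmap = (\<lambda>M N f m. restrict f (carrier (cterm (stalk_complex M) m)))\<rparr>"

definition derived_embedding ::
    "(('a::fd_complex_algebra, 'm) module, 'm \<Rightarrow> 'm,
      ('a, 'm) cochain_complex, ('a, 'm) derived_morphism) functor_data"
  where "derived_embedding = comp_functor to_derived stalk_functor"

end

theory Submission
  imports Defs
begin

text \<open>The set of average central integrals is the center itself.  A constant function on the cube
  averages to its value, because the cube has positive finite measure; this gives one inclusion and
  shows that the correspondence in question is the identity of the center.  The other inclusion says
  that the integral of a function with central values is central (\<open>integral_in_center\<close>).  An element
  is central when all the maps \<open>x \<mapsto> x a - a x\<close> kill it.  These maps are linear on a
  finite-dimensional space, hence bounded, hence commute with the Bochner integral.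

  Once \<open>u\<close> is known to be central, multiplication by \<open>u\<close> is linear over the algebra, commutes with
  all homomorphisms of modules, and in particular with differentials and chain maps.  So it is an
  endotransformation of the identity on modules and, degree by degree, on bounded complexes.

  The derived category is the localization of the category of bounded complexes at the
  quasi-isomorphisms.  For an arbitrary category and an arbitrary class of morphisms, a natural
  endotransformation of the identity descends to the localization
  (\<open>natural_transformation_localization\<close>): it commutes with the inverse of every morphism that it
  commutes with.  The descended transformation lifts the one on modules because the embedding of
  modules as complexes in degree \<open>0\<close> is a functor that carries \<open>\<rho>\<^sub>M(u)\<close> to multiplication by \<open>u\<close> on
  the stalk complex.\<close>

section \<open>Linear maps on finite-dimensional normed spaces\<close>

lemma compact_Pi_UNIV:
  fixes K :: "'i \<Rightarrow> 'b::topological_space set"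
  assumes "\<And>i. compact (K i)"
  shows "compact (Pi\<^sub>E UNIV K)"
proof -
  have "compactin (product_topology (\<lambda>i. euclidean) UNIV) (Pi\<^sub>E UNIV K)"
    using assms by (simp add: compactin_PiE)
  then show ?thesis
    by (simp add: euclidean_product_topology)
qed

text \<open>The coordinates with respect to a finite independent set are bounded functions of the vector.
  The proof is compactness, one face of the cube \<open>[-1, 1]\<^sup>B\<close> at a time: on the face where the \<open>b\<close>-th
  coordinate is \<open>1\<close>, the norm of the linear combination attains a minimum, which is positive by
  independence.  A vector whose largest coordinate is the \<open>b\<close>-th is a multiple of one on that face.\<close>

lemma norm_sum_ge_coordinate:
  fixes B :: "'a::real_normed_vector set"
  assumes "finite B" "independent B" "b \<in> B"
  obtains d where "d > 0" and "\<And>c. (\<forall>i\<in>B. \<bar>c i\<bar> \<le> \<bar>c b\<bar>) \<Longrightarrow> d * \<bar>c b\<bar> \<le> norm (\<Sum>i\<in>B. c i *\<^sub>R i)"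
proof -
  \<comment> \<open>\<open>K\<close> is a face in all coordinates, also those outside \<open>B\<close>, to be compact in the product topology.\<close>
  define K :: "('a \<Rightarrow> real) set" where "K = Pi\<^sub>E UNIV (\<lambda>i. if i = b then {1} else {-1..1})"
  let ?T = "\<lambda>c. \<Sum>i\<in>B. c i *\<^sub>R i"
  have "compact K"
    unfolding K_def by (rule compact_Pi_UNIV) auto
  moreover have "continuous_on K (\<lambda>c. norm (?T c))"
    by (intro continuous_intros continuous_on_subset[OF continuous_on_product_coordinates]) auto
  moreover have "(\<lambda>i. if i = b then 1 else 0) \<in> K"
    by (auto simp: K_def)
  ultimately obtain e where e: "e \<in> K" "\<And>c. c \<in> K \<Longrightarrow> norm (?T e) \<le> norm (?T c)"
    using continuous_attains_inf[of K "\<lambda>c. norm (?T c)"] by blast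
  have "e b = 1"
    using e(1) by (auto simp: K_def split: if_splits)
  then have "?T e \<noteq> 0"
    using assms independentD by (metis order_refl zero_neq_one)
  moreover have "norm (?T e) * \<bar>c b\<bar> \<le> norm (?T c)" if c: "\<forall>i\<in>B. \<bar>c i\<bar> \<le> \<bar>c b\<bar>" for c
  proof (cases "c b = 0")
    case False
    define c' where "c' i = (if i \<in> B then c i / c b else 0)" for i
    have "\<bar>c' i\<bar> \<le> 1" for i
      using c False by (simp add: c'_def abs_divide)
    then have "c' \<in> K"
      using False assms(3) by (auto simp: K_def c'_def abs_le_iff minus_le_iff)
    moreover have "?T c = c b *\<^sub>R ?T c'"
      using False by (simp add: c'_def scaleR_sum_right)
    ultimately show ?thesis
      using e(2)[of c'] by (simp add: mult.commute mult_left_mono)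
  qed simp
  ultimately show thesis
    using that[of "norm (?T e)"] by simp
qed

text \<open>One constant for all coordinates: the least of the constants of the finitely many faces.\<close>

lemma norm_sum_ge_all_coordinates:
  fixes B :: "'a::real_normed_vector set"
  assumes "finite B" "independent B"
  obtains d where "d > 0" and "\<And>c i. i \<in> B \<Longrightarrow> d * \<bar>c i\<bar> \<le> norm (\<Sum>i\<in>B. c i *\<^sub>R i)"
proof -
  have "\<exists>d. \<forall>b\<in>B. d b > 0 \<and> (\<forall>c. (\<forall>i\<in>B. \<bar>c i\<bar> \<le> \<bar>c b\<bar>) \<longrightarrow> d b * \<bar>c b\<bar> \<le> norm (\<Sum>i\<in>B. c i *\<^sub>R i))"
  proof (intro bchoice ballI)
    fix b assume "b \<in> B"
    show "\<exists>e>0. \<forall>c. (\<forall>i\<in>B. \<bar>c i\<bar> \<le> \<bar>c b\<bar>) \<longrightarrow> e * \<bar>c b\<bar> \<le> norm (\<Sum>i\<in>B. c i *\<^sub>R i)"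
      by (rule norm_sum_ge_coordinate[OF assms \<open>b \<in> B\<close>]) blast
  qed
  then obtain d where d: "\<And>b. b \<in> B \<Longrightarrow> d b > 0"
    "\<And>b c. b \<in> B \<Longrightarrow> (\<forall>i\<in>B. \<bar>c i\<bar> \<le> \<bar>c b\<bar>) \<Longrightarrow> d b * \<bar>c b\<bar> \<le> norm (\<Sum>i\<in>B. c i *\<^sub>R i)"
    by blast
  \<comment> \<open>The \<open>1\<close> is there for the case that \<open>B\<close> is empty.\<close>
  define m where "m = Min (insert 1 (d ` B))"
  have m: "m \<le> d b" if "b \<in> B" for b
    using that assms(1) by (simp add: m_def)
  have "m > 0"
    using assms(1) d(1) by (simp add: m_def)
  moreover have "m * \<bar>c i\<bar> \<le> norm (\<Sum>i\<in>B. c i *\<^sub>R i)" if "i \<in> B" for c i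
  proof -
    obtain b where b: "b \<in> B" "\<forall>j\<in>B. \<bar>c j\<bar> \<le> \<bar>c b\<bar>"
    proof -
      obtain b where b: "b \<in> B" "Max ((\<lambda>i. \<bar>c i\<bar>) ` B) = \<bar>c b\<bar>"
        by (rule obtains_MAX[OF assms(1), of "\<lambda>i. \<bar>c i\<bar>"]) (use \<open>i \<in> B\<close> in auto)
      have "\<bar>c j\<bar> \<le> \<bar>c b\<bar>" if "j \<in> B" for j
        using that assms(1) unfolding b(2)[symmetric] by simp
      with b(1) show thesis
        by (intro that) auto
    qed
    have "m * \<bar>c i\<bar> \<le> d b * \<bar>c b\<bar>"
      using b that m d(1)[OF b(1)] by (intro mult_mono) auto
    also have "\<dots> \<le> norm (\<Sum>i\<in>B. c i *\<^sub>R i)"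
      by (rule d(2)) (use b in auto)
    finally show ?thesis .
  qed
  ultimately show thesis
    using that by blast
qed

text \<open>The norm of the algebra is arbitrary, so the continuity of multiplication by a fixed element has
  to come from finite dimension.\<close>

lemma linear_imp_bounded_linear_finite_span:
  fixes f :: "'a::real_normed_vector \<Rightarrow> 'b::real_normed_vector"
    and S :: "'a set"
  assumes "linear f" "finite S" "span S = UNIV"
  shows "bounded_linear f"
proof -
  obtain B :: "'a set" where B: "B \<subseteq> S" "independent B" "S \<subseteq> span B"
    using maximal_independent_subset[of S] by blast
  have "span B = UNIV"
    using span_mono[OF B(3)] assms(3) by (auto simp: span_span)
  note B = B(1,2) this
  have finB: "finite B"
    using B(1) assms(2) by (rule finite_subset)
  obtain d where d: "d > 0" "\<And>c i. i \<in> B \<Longrightarrow> d * \<bar>c i\<bar> \<le> norm (\<Sum>i\<in>B. c i *\<^sub>R i)"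
    using norm_sum_ge_all_coordinates[OF finB B(2)] by blast
  have "norm (f x) \<le> norm x * ((\<Sum>b\<in>B. norm (f b)) / d)" for x
  proof -
    let ?c = "representation B x"
    have x: "(\<Sum>b\<in>B. ?c b *\<^sub>R b) = x"
      using B finB by (intro sum_representation_eq) auto
    have c: "\<bar>?c b\<bar> \<le> norm x / d" if "b \<in> B" for b
      using d(2)[OF that, of ?c] d(1) x by (simp add: field_simps)
    have "norm (f x) = norm (\<Sum>b\<in>B. ?c b *\<^sub>R f b)"
      by (subst x[symmetric]) (simp add: linear_sum[OF assms(1)] linear_cmul[OF assms(1)])
    also have "\<dots> \<le> (\<Sum>b\<in>B. \<bar>?c b\<bar> * norm (f b))"
      by (rule order_trans[OF norm_sum]) simp
    also have "\<dots> \<le> (\<Sum>b\<in>B. norm x / d * norm (f b))"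
      by (intro sum_mono mult_right_mono c) auto
    also have "\<dots> = norm x * ((\<Sum>b\<in>B. norm (f b)) / d)"
      by (simp add: sum_distrib_left sum_divide_distrib)
    finally show ?thesis .
  qed
  then show ?thesis
    by (intro bounded_linear_intro linear_add linear_cmul assms(1))
qed

text \<open>Complex generators \<open>b\<close> together with their multiples \<open>\<i> b\<close> generate over the reals, the scalars for
  which boundedness of linear maps was shown.\<close>

lemma finite_real_span:
  obtains S :: "'a::fd_complex_algebra set" where "finite S" "span S = UNIV"
proof -
  obtain B :: "'a set" where B: "finite B" "\<And>x. \<exists>c. x = (\<Sum>b\<in>B. c b *\<^sub>C b)"
    using finite_dimensional by blast
  have complex: "c *\<^sub>C x = Re c *\<^sub>R x + Im c *\<^sub>R (\<i> *\<^sub>C x)" for c and x :: 'a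
    by (simp add: scaleR_scaleC scaleC_scaleC flip: scaleC_add_left)
      (metis complex_eq mult.commute)
  let ?S = "B \<union> (\<lambda>b. \<i> *\<^sub>C b) ` B"
  have "c *\<^sub>C b \<in> span ?S" if "b \<in> B" for c b
    by (subst complex) (use that in \<open>auto intro!: span_add span_scale intro: span_base\<close>)
  then have "x \<in> span ?S" for x
  proof -
    obtain c where "x = (\<Sum>b\<in>B. c b *\<^sub>C b)"
      using B(2) by blast
    also have "\<dots> \<in> span ?S"
      by (rule span_sum) fact
    finally show ?thesis .
  qed
  then show thesis
    using that[of ?S] B(1) by auto
qed

lemma bounded_linear_commutator:
  fixes a :: "'a::fd_complex_algebra"
  shows "bounded_linear (\<lambda>x. x * a - a * x)"
proof -
  have "(t *\<^sub>R x) * a = t *\<^sub>R (x * a)" "a * (t *\<^sub>R x) = t *\<^sub>R (a * x)" for t x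
    by (simp_all add: scaleR_scaleC mult_scaleC_left mult_scaleC_right)
  then have "linear (\<lambda>x. x * a - a * x)"
    by (intro linearI) (simp_all add: distrib_left distrib_right scaleR_right_diff_distrib)
  moreover obtain S :: "'a set" where "finite S" "span S = UNIV"
    by (rule finite_real_span)
  ultimately show ?thesis
    by (rule linear_imp_bounded_linear_finite_span)
qed

text \<open>The center is the intersection of the kernels of the commutators \<open>x \<mapsto> x a - a x\<close>, and an integral
  may be exchanged with each of these bounded linear maps.\<close>

lemma integral_in_center:
  fixes f :: "'b \<Rightarrow> 'a::fd_complex_algebra"
  assumes "integrable M f" "AE x in M. f x \<in> center"
  shows "(LINT x|M. f x) \<in> center"
proof -
  have "(LINT x|M. f x) * a - a * (LINT x|M. f x) = 0" for a
  proof -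
    have "(LINT x|M. f x) * a - a * (LINT x|M. f x) = (LINT x|M. f x * a - a * f x)"
      by (rule integral_bounded_linear[OF bounded_linear_commutator assms(1), symmetric])
    also have "\<dots> = (LINT x|M. 0)"
      using assms
      by (intro integral_cong_AE borel_measurable_integrable
          integrable_bounded_linear[OF bounded_linear_commutator]) (auto simp: center_def)
    finally show ?thesis by simp
  qed
  then show ?thesis
    by (auto simp: center_def)
qed

section \<open>The cube and its average central integrals\<close>

lemma subalgebra_center: "subalgebra (center :: 'a::fd_complex_algebra set)"
proof -
  have "x * y \<in> center" if "x \<in> center" "y \<in> center" for x y :: 'a
  proof -
    have "x * y * a = a * (x * y)" for a
    proof -
      have "x * (y * a) = x * (a * y)" "x * a * y = a * x * y"
        using that by (simp_all add: center_def)
      then show ?thesis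
        by (simp add: mult.assoc)
    qed
    then show ?thesis
      by (simp add: center_def)
  qed
  moreover have "x + y \<in> center" if "x \<in> center" "y \<in> center" for x y :: 'a
    using that by (simp add: center_def distrib_left distrib_right)
  moreover have "c *\<^sub>C x \<in> center" if "x \<in> center" for c and x :: 'a
    using that by (simp add: center_def mult_scaleC_left mult_scaleC_right)
  moreover have "0 \<in> (center :: 'a set)" "1 \<in> (center :: 'a set)"
    by (simp_all add: center_def)
  ultimately show ?thesis
    unfolding subalgebra_def by blast
qed

lemma inj_on_cube_param:
  assumes "center_basis k z"
  shows "inj_on (cube_param k z) ({..<k} \<rightarrow>\<^sub>E A)"
proof (rule inj_onI)
  fix l l' assume l: "l \<in> {..<k} \<rightarrow>\<^sub>E A" "l' \<in> {..<k} \<rightarrow>\<^sub>E A"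
    and eq: "cube_param k z l = cube_param k z l'"
  have "complex_of_real (l i) *\<^sub>C z i = complex_of_real (l i - l' i) *\<^sub>C z i + complex_of_real (l' i) *\<^sub>C z i" for i
    by (simp flip: scaleC_add_left)
  then have "(\<Sum>i<k. complex_of_real (l i - l' i) *\<^sub>C z i) = 0"
    using eq by (simp add: cube_param_def sum.distrib)
  with assms have "\<forall>i<k. complex_of_real (l i - l' i) = 0"
    unfolding center_basis_def by (elim conjE allE[of _ "\<lambda>i. complex_of_real (l i - l' i)"]) blast
  then have "l i = l' i" if "i < k" for i
    using that by simp
  then show "l = l'"
    using l by (intro PiE_ext) auto
qed

lemma space_cube_measure: "space (cube_measure k z r s) = cube k z r s"
  by (auto simp: cube_measure_def cube_def space_embed_measure space_restrict_space space_PiM)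

text \<open>Independence of the \<open>z i\<close> makes the parametrization injective, so the transported measure of the
  whole cube is the Lebesgue measure of \<open>[r, s]\<^sup>k\<close>.  For \<open>k = 0\<close> it is \<open>1\<close>.\<close>

lemma emeasure_cube:
  assumes "center_basis k z" "r \<le> s"
  shows "emeasure (cube_measure k z r s) (cube k z r s) = ennreal ((s - r) ^ k)"
proof -
  interpret product_sigma_finite "\<lambda>_. lborel :: real measure" ..
  let ?P = "PiM {..<k} (\<lambda>_. lborel :: real measure)" and ?Q = "{..<k} \<rightarrow>\<^sub>E {r..s}"
  have Q: "?Q \<in> sets ?P"
    by (intro sets_PiM_I_finite) auto
  have sp: "space (restrict_space (completion ?P) ?Q) = ?Q"
    using sets.sets_into_space[OF Q] by (auto simp: space_restrict_space)
  have "emeasure (cube_measure k z r s) (cube k z r s) = emeasure (restrict_space (completion ?P) ?Q) ?Q"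
    unfolding cube_measure_def cube_def
    by (rule emeasure_embed_measure_image')
      (use sp sets.top[of "restrict_space (completion ?P) ?Q"] inj_on_cube_param[OF assms(1)] in auto)
  also have "\<dots> = emeasure ?P ?Q"
    using Q by (subst emeasure_restrict_space) (auto simp: Int_absorb2 sets.sets_into_space main_part_sets)
  also have "\<dots> = (\<Prod>i<k. emeasure lborel {r..s})"
    by (rule emeasure_PiM) auto
  also have "\<dots> = ennreal ((s - r) ^ k)"
    using assms(2) by (simp add: ennreal_power)
  finally show ?thesis .
qed

lemma finite_measure_cube:
  assumes "center_basis k z" "r \<le> s"
  shows "finite_measure (cube_measure k z r s)"
  using assms by (intro finite_measureI) (simp add: space_cube_measure emeasure_cube)

lemma average_const:
  assumes "finite_measure \<mu>" "measure \<mu> (space \<mu>) > 0"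
  shows "average \<mu> (space \<mu>) (\<lambda>_. c) = c"
proof -
  interpret finite_measure \<mu> by fact
  show ?thesis
    using assms(2) by (simp add: average_def set_integral_space)
qed

lemma average_in_center:
  fixes f :: "'a::fd_complex_algebra \<Rightarrow> 'a"
  assumes "integrable \<mu> f" "AE x in \<mu>. f x \<in> center" "J \<in> sets \<mu>"
  shows "average \<mu> J f \<in> center"
proof -
  have scaleR: "t *\<^sub>R x \<in> center" if "x \<in> center" for t and x :: 'a
    using that subalgebra_center by (auto simp: subalgebra_def scaleR_scaleC)
  have "AE x in \<mu>. indicator J x *\<^sub>R f x \<in> center"
    using assms(2) by eventually_elim (rule scaleR)
  then have "(LINT x:J|\<mu>. f x) \<in> center"
    unfolding set_lebesgue_integral_def
    by (intro integral_in_center integrable_mult_indicator assms)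
  then show ?thesis
    unfolding average_def by (rule scaleR)
qed

text \<open>Averages of central functions are central; conversely a central element is the average over the
  whole space of the constant function with that value.\<close>

lemma ACI_eq_center:
  assumes "finite_measure \<mu>" "measure \<mu> (space \<mu>) > 0"
  shows "ACI \<mu> = center"
proof (intro equalityI subsetI)
  fix u assume "u \<in> ACI \<mu>"
  then show "u \<in> center"
    by (auto simp: ACI_def central_condition_def average_in_center)
next
  interpret finite_measure \<mu> by fact
  fix c :: 'a assume "c \<in> center"
  then have "integrable \<mu> (\<lambda>_. c)" "central_condition \<mu> (\<lambda>_. c)"
    by (simp_all add: central_condition_def)
  then have "average \<mu> (space \<mu>) (\<lambda>_. c) \<in> ACI \<mu>"
    using assms(2) unfolding ACI_def by blast
  then show "c \<in> ACI \<mu>"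
    using average_const[OF assms] by simp
qed

section \<open>Localization of a category\<close>

lemma zigzag_endpoints:
  "zigzag C W X p Y \<Longrightarrow> X \<in> Obj C \<and> Y \<in> Obj C"
  by (induction rule: zigzag.induct) auto

lemma zigzag_append:
  "zigzag C W X p Y \<Longrightarrow> zigzag C W Y q Z \<Longrightarrow> zigzag C W X (p @ q) Z"
  by (induction rule: zigzag.induct) (auto intro: zigzag.intros)

context
  fixes C :: "('o, 'f) category" and W :: "'o \<Rightarrow> 'o \<Rightarrow> 'f \<Rightarrow> bool"
  assumes C: "is_category C"
begin

lemma zigzag_eq_imp_zigzag:
  "zigzag_eq C W X Y p q \<Longrightarrow> zigzag C W X p Y \<and> zigzag C W X q Y"
proof (induction rule: zigzag_eq.induct)
  case (zz_comp X Y Z f g)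
  moreover from zz_comp have "Comp C X Y Z g f \<in> Hom C X Z"
    using C unfolding is_category_def by blast
  ultimately show ?case by (auto intro!: zigzag.intros)
next
  case (zz_ident X)
  moreover from zz_ident have "Ident C X \<in> Hom C X X"
    using C unfolding is_category_def by blast
  ultimately show ?case by (auto intro!: zigzag.intros)
qed (auto intro: zigzag.intros zigzag_append)

lemma zigzag_class_eq_iff:
  assumes "zigzag C W X p Y"
  shows "zigzag_class C W X Y p = zigzag_class C W X Y q \<longleftrightarrow> zigzag_eq C W X Y p q"
  using assms unfolding zigzag_class_def
  by (blast intro: zz_refl zz_sym zz_trans)

text \<open>Composition of classes is defined as a union over all representatives; congruence of the zigzag
  relation under concatenation makes all the sets in this union equal.\<close>

lemma Comp_localization:
  assumes "zigzag C W X p Y" and "zigzag C W Y q Z"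
  shows "Comp (localization C W) X Y Z (zigzag_class C W Y Z q) (zigzag_class C W X Y p)
    = zigzag_class C W X Z (p @ q)"
proof -
  have "zigzag_class C W X Z (p' @ q') = zigzag_class C W X Z (p @ q)"
    if "p' \<in> zigzag_class C W X Y p" "q' \<in> zigzag_class C W Y Z q" for p' q'
  proof -
    have "zigzag_eq C W X Z (p @ q) (p' @ q')"
      using that by (auto simp: zigzag_class_def intro: zz_append)
    then show ?thesis
      using zigzag_class_eq_iff zigzag_append[OF assms] by metis
  qed
  moreover have "p \<in> zigzag_class C W X Y p" "q \<in> zigzag_class C W Y Z q"
    using assms by (auto simp: zigzag_class_def intro: zz_refl)
  ultimately have "(\<Union>p'\<in>zigzag_class C W X Y p. \<Union>q'\<in>zigzag_class C W Y Z q.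
      zigzag_class C W X Z (p' @ q')) = zigzag_class C W X Z (p @ q)"
    by blast
  then show ?thesis
    by (simp add: localization_def)
qed

lemma Hom_localizationE:
  assumes "F \<in> Hom (localization C W) X Y"
  obtains p where "zigzag C W X p Y" and "F = zigzag_class C W X Y p"
  using assms by (auto simp: localization_def)

lemma zigzag_class_in_Hom:
  "zigzag C W X p Y \<Longrightarrow> zigzag_class C W X Y p \<in> Hom (localization C W) X Y"
  by (auto simp: localization_def)

lemma Obj_localization [simp]: "Obj (localization C W) = Obj C"
  by (simp add: localization_def)

lemma Ident_localization [simp]: "Ident (localization C W) X = zigzag_class C W X X []"
  by (simp add: localization_def)

lemma is_category_localization: "is_category (localization C W)"
  unfolding is_category_def
  by (auto elim!: Hom_localizationE
      simp: Comp_localization zigzag_append zigzag_Nil zigzag_class_in_Hom)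

lemma is_functor_localization_functor:
  "is_functor C (localization C W) (localization_functor C W)"
proof -
  have "zigzag_class C W X X [Fwd X (Ident C X) X] = zigzag_class C W X X []" if "X \<in> Obj C" for X
    using zz_ident[OF that] zigzag_class_eq_iff zigzag_eq_imp_zigzag by metis
  moreover have "zigzag_class C W X Z [Fwd X (Comp C X Y Z g f) Z] =
      Comp (localization C W) X Y Z (zigzag_class C W Y Z [Fwd Y g Z]) (zigzag_class C W X Y [Fwd X f Y])"
    if "X \<in> Obj C" "Y \<in> Obj C" "Z \<in> Obj C" "f \<in> Hom C X Y" "g \<in> Hom C Y Z" for X Y Z f g
  proof -
    have "zigzag C W X [Fwd X f Y] Y" "zigzag C W Y [Fwd Y g Z] Z"
      using that by (auto intro: zigzag.intros)
    then show ?thesis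
      using zz_comp[OF that] zigzag_class_eq_iff[OF zigzag_append[of C W X _ Y]]
      by (fastforce simp: Comp_localization intro: sym)
  qed
  ultimately show ?thesis
    using C is_category_localization
    unfolding is_functor_def localization_functor_def
    by (auto intro!: zigzag_class_in_Hom zigzag.intros)
qed

lemma zigzag_eq_prefix:
  assumes "zigzag_eq C W Y Z q q'" and "zigzag C W X p Y"
  shows "zigzag_eq C W X Z (p @ q) (p @ q')"
  using assms by (blast intro: zz_append zz_refl)

lemma zigzag_eq_suffix:
  assumes "zigzag_eq C W X Y p p'" and "zigzag C W Y q Z"
  shows "zigzag_eq C W X Z (p @ q) (p' @ q)"
  using assms by (blast intro: zz_append zz_refl)

context
  fixes \<eta> :: "'o \<Rightarrow> 'f"
  assumes \<eta>: "natural_transformation C C identity_functor identity_functor \<eta>"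
begin

lemma component_in_Hom: "X \<in> Obj C \<Longrightarrow> \<eta> X \<in> Hom C X X"
  using \<eta> by (auto simp: natural_transformation_def identity_functor_def)

lemma zigzag_component: "X \<in> Obj C \<Longrightarrow> zigzag C W X [Fwd X (\<eta> X) X] X"
  by (auto intro!: zigzag.intros component_in_Hom)

lemma component_commutes_Fwd:
  assumes "X \<in> Obj C" "Y \<in> Obj C" "f \<in> Hom C X Y"
  shows "zigzag_eq C W X Y [Fwd X f Y, Fwd Y (\<eta> Y) Y] [Fwd X (\<eta> X) X, Fwd X f Y]"
proof -
  have "Comp C X Y Y (\<eta> Y) f = Comp C X X Y f (\<eta> X)"
    using \<eta> assms by (auto simp: natural_transformation_def identity_functor_def)
  then show ?thesis
    using zz_comp[of X C Y Y f "\<eta> Y" W] zz_comp[of X C X Y "\<eta> X" f W] assms component_in_Hom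
    by (metis zz_sym zz_trans)
qed

text \<open>A natural transformation is compatible with formal inverses as soon as it is compatible with the
  inverted morphism \<open>s\<close>: from \<open>s \<eta>\<^sub>Y = \<eta>\<^sub>X s\<close> one gets
  \<open>\<eta>\<^sub>Y s\<^sup>-\<^sup>1 = s\<^sup>-\<^sup>1 s \<eta>\<^sub>Y s\<^sup>-\<^sup>1 = s\<^sup>-\<^sup>1 \<eta>\<^sub>X s s\<^sup>-\<^sup>1 = s\<^sup>-\<^sup>1 \<eta>\<^sub>X\<close>.\<close>

lemma component_commutes_Bwd:
  assumes "X \<in> Obj C" "Y \<in> Obj C" "s \<in> Hom C Y X" "W Y X s"
  shows "zigzag_eq C W X Y [Bwd X s Y, Fwd Y (\<eta> Y) Y] [Fwd X (\<eta> X) X, Bwd X s Y]"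
proof -
  let ?s = "Fwd Y s X" and ?t = "Bwd X s Y" and ?x = "Fwd X (\<eta> X) X" and ?y = "Fwd Y (\<eta> Y) Y"
  have s: "zigzag C W Y [?s] X" and t: "zigzag C W X [?t] Y"
    using assms by (auto intro!: zigzag.intros)
  note zx = zigzag_component[OF assms(1)] and zy = zigzag_component[OF assms(2)]
  have ty: "zigzag C W X [?t, ?y] Y"
    using zigzag_append[OF t zy] by simp
  have xt: "zigzag C W X [?x, ?t] Y"
    using zigzag_append[OF zx t] by simp
  note [trans] = zz_trans
  have "zigzag_eq C W X Y [?t, ?y] [?t, ?y, ?s, ?t]"
    using zz_sym[OF zigzag_eq_prefix[OF zz_inv_right[of Y C X s W] ty]] assms by simp
  also have "zigzag_eq C W X Y [?t, ?y, ?s, ?t] [?t, ?s, ?x, ?t]"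
    using zigzag_eq_prefix[OF zigzag_eq_suffix[OF
        zz_sym[OF component_commutes_Fwd[OF assms(2,1,3)]] t] t] by simp
  also have "zigzag_eq C W X Y [?t, ?s, ?x, ?t] [?x, ?t]"
    using zigzag_eq_suffix[OF zz_inv_left[of Y C X s W] xt] assms by simp
  finally show ?thesis .
qed

lemma component_commutes_zigzag:
  "zigzag C W X p Y \<Longrightarrow> zigzag_eq C W X Y (p @ [Fwd Y (\<eta> Y) Y]) (Fwd X (\<eta> X) X # p)"
proof (induction rule: zigzag.induct)
  case (zigzag_Nil X)
  then show ?case by (auto intro: zz_refl zigzag_component)
next
  case (zigzag_Fwd X Y f p Z)
  then have "zigzag C W X [Fwd X f Y] Y" by (auto intro: zigzag.intros)
  from zigzag_eq_prefix[OF zigzag_Fwd.IH this]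
  show ?case
    using zigzag_eq_suffix[OF component_commutes_Fwd zigzag_Fwd.hyps(4)] zigzag_Fwd.hyps(1-3)
    by (auto intro: zz_trans)
next
  case (zigzag_Bwd X Y s p Z)
  then have "zigzag C W X [Bwd X s Y] Y" by (auto intro: zigzag.intros)
  from zigzag_eq_prefix[OF zigzag_Bwd.IH this]
  show ?case
    using zigzag_eq_suffix[OF component_commutes_Bwd zigzag_Bwd.hyps(5)] zigzag_Bwd.hyps(1-4)
    by (auto intro: zz_trans)
qed

text \<open>Naturality in the localization has to be tested on zigzags, where it follows step by step.\<close>

lemma natural_transformation_localization:
  "natural_transformation (localization C W) (localization C W) identity_functor identity_functor
    (\<lambda>X. fmap (localization_functor C W) X X (\<eta> X))"
proof -
  have "Comp (localization C W) X Y Y (zigzag_class C W Y Y [Fwd Y (\<eta> Y) Y]) F =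
      Comp (localization C W) X X Y F (zigzag_class C W X X [Fwd X (\<eta> X) X])"
    if F_in: "F \<in> Hom (localization C W) X Y" for X Y F
  proof -
    obtain p where p: "zigzag C W X p Y" and F: "F = zigzag_class C W X Y p"
      using F_in by (rule Hom_localizationE)
    have X: "zigzag C W X [Fwd X (\<eta> X) X] X" and Y: "zigzag C W Y [Fwd Y (\<eta> Y) Y] Y"
      using zigzag_endpoints[OF p] by (auto intro: zigzag_component)
    show ?thesis
      using zigzag_class_eq_iff[OF zigzag_append[OF p Y]] component_commutes_zigzag[OF p] p X Y
      by (simp add: F Comp_localization)
  qed
  then show ?thesis
    unfolding natural_transformation_def
    by (auto simp: is_functor_def identity_functor_def is_category_localization
        localization_functor_def intro: zigzag_class_in_Hom zigzag_component)
qed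

end

end

section \<open>Central elements act on modules and on bounded complexes\<close>

lemma fd_left_module_imp_left_module: "fd_left_module M \<Longrightarrow> left_module M"
  by (simp add: fd_left_module_def)

lemma (in left_module) smult_zero: "a \<odot> \<zero> = \<zero>"
  by (metis smult_add_right smult_closed add.r_cancel_one' l_zero zero_closed)

lemma left_module_hom_zero:
  assumes "left_module M" "left_module N" "f \<in> left_module_hom M N"
  shows "f \<zero>\<^bsub>M\<^esub> = \<zero>\<^bsub>N\<^esub>"
proof -
  interpret M: left_module M by fact
  interpret N: left_module N by fact
  have "f \<zero>\<^bsub>M\<^esub> \<in> carrier N"
    using assms(3) by (auto simp: left_module_hom_def)
  moreover have "f (\<zero>\<^bsub>M\<^esub> \<oplus>\<^bsub>M\<^esub> \<zero>\<^bsub>M\<^esub>) = f \<zero>\<^bsub>M\<^esub> \<oplus>\<^bsub>N\<^esub> f \<zero>\<^bsub>M\<^esub>"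
    using assms(3) M.zero_closed unfolding left_module_hom_def by blast
  ultimately show ?thesis
    by (metis M.zero_closed M.l_zero N.add.r_cancel_one')
qed

lemma ident_in_left_module_hom:
  assumes "left_module M"
  shows "(\<lambda>x\<in>carrier M. x) \<in> left_module_hom M M"
proof -
  interpret M: left_module M by fact
  show ?thesis
    by (auto simp: left_module_hom_def M.smult_closed)
qed

lemma compose_in_left_module_hom:
  assumes "left_module L" "f \<in> left_module_hom L M" "g \<in> left_module_hom M N"
  shows "compose (carrier L) g f \<in> left_module_hom L N"
proof -
  interpret L: left_module L by fact
  have "f x \<in> carrier M" if "x \<in> carrier L" for x
    using that assms(2) by (auto simp: left_module_hom_def)
  then show ?thesis
    using assms(2,3)
    by (auto simp: left_module_hom_def compose_def L.smult_closed)
qed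

lemma compose_left_module_hom_ident:
  assumes "f \<in> left_module_hom M N"
  shows "compose (carrier M) f (\<lambda>x\<in>carrier M. x) = f"
    and "compose (carrier M) (\<lambda>x\<in>carrier N. x) f = f"
  using assms by (auto simp: left_module_hom_def PiE_def intro: compose_Id Id_compose)

lemma compose_left_module_hom_assoc:
  assumes "f \<in> left_module_hom L M"
  shows "compose (carrier L) (compose (carrier M) h g) f = compose (carrier L) h (compose (carrier L) g f)"
  using assms by (auto simp: left_module_hom_def intro!: compose_assoc[symmetric])

lemma is_category_fd_modules: "is_category fd_modules"
  unfolding is_category_def fd_modules_def
  by (auto simp: fd_left_module_imp_left_module ident_in_left_module_hom compose_in_left_module_hom
      compose_left_module_hom_ident compose_left_module_hom_assoc)

text \<open>Centrality of \<open>u\<close> is what makes multiplication by \<open>u\<close> linear over the algebra.\<close>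

lemma structure_hom_in_left_module_hom:
  assumes "left_module M" "u \<in> center"
  shows "structure_hom M u \<in> left_module_hom M M"
proof -
  interpret M: left_module M by fact
  have "u \<odot>\<^bsub>M\<^esub> (a \<odot>\<^bsub>M\<^esub> x) = a \<odot>\<^bsub>M\<^esub> (u \<odot>\<^bsub>M\<^esub> x)" if "x \<in> carrier M" for a x
    using that assms(2) by (simp add: center_def flip: M.smult_smult)
  then show ?thesis
    by (auto simp: left_module_hom_def structure_hom_def M.smult_closed M.smult_add_right)
qed

text \<open>Linearity of \<open>f\<close> for the single element \<open>u\<close> is the naturality square, and also, with a
  differential for \<open>f\<close>, the condition on chain maps.\<close>

lemma structure_hom_commutes:
  assumes "left_module M" "f \<in> left_module_hom M N"
  shows "compose (carrier M) (structure_hom N u) f = compose (carrier M) f (structure_hom M u)"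
proof -
  interpret M: left_module M by fact
  show ?thesis
    using assms(2)
    by (auto simp: left_module_hom_def structure_hom_def compose_def M.smult_closed fun_eq_iff)
qed

lemma is_functor_identity_functor: "is_category C \<Longrightarrow> is_functor C C identity_functor"
  by (simp add: is_functor_def identity_functor_def)

lemma natural_transformation_structure_hom:
  assumes "u \<in> center"
  shows "natural_transformation fd_modules fd_modules identity_functor identity_functor
    (\<lambda>M. structure_hom M u)"
  using is_functor_identity_functor[OF is_category_fd_modules]
  unfolding natural_transformation_def
  by (simp add: identity_functor_def fd_modules_def fd_left_module_imp_left_module
      structure_hom_in_left_module_hom assms structure_hom_commutes)

lemma bounded_complex_left_module: "bounded_complex X \<Longrightarrow> left_module (cterm X m)"
  by (simp add: bounded_complex_def fd_left_module_imp_left_module)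

lemma chain_map_left_module_hom: "f \<in> chain_map X Y \<Longrightarrow> f m \<in> left_module_hom (cterm X m) (cterm Y m)"
  by (simp add: chain_map_def)

lemma left_module_hom_mem: "f \<in> left_module_hom M N \<Longrightarrow> x \<in> carrier M \<Longrightarrow> f x \<in> carrier N"
  by (auto simp: left_module_hom_def)

lemma ident_in_chain_map:
  assumes "bounded_complex X"
  shows "(\<lambda>m. \<lambda>x\<in>carrier (cterm X m). x) \<in> chain_map X X"
  using assms left_module_hom_mem
  by (fastforce simp: chain_map_def ident_in_left_module_hom bounded_complex_left_module
      bounded_complex_def)

lemma compose_in_chain_map:
  assumes "bounded_complex X" "f \<in> chain_map X Y" "g \<in> chain_map Y Z"
  shows "(\<lambda>m. compose (carrier (cterm X m)) (g m) (f m)) \<in> chain_map X Z"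
proof -
  have "cdiff X m x \<in> carrier (cterm X (m + 1))" if "x \<in> carrier (cterm X m)" for m x
    using that assms(1) left_module_hom_mem by (fastforce simp: bounded_complex_def)
  moreover have "f m x \<in> carrier (cterm Y m)" if "x \<in> carrier (cterm X m)" for m x
    using that chain_map_left_module_hom[OF assms(2)] left_module_hom_mem by fast
  ultimately show ?thesis
    using assms
    by (auto simp: chain_map_def compose_eq bounded_complex_left_module
        intro!: compose_in_left_module_hom)
qed

lemma is_category_bounded_complexes: "is_category bounded_complexes"
  unfolding is_category_def bounded_complexes_def
  by (auto simp: ident_in_chain_map compose_in_chain_map; rule ext;
      rule compose_left_module_hom_ident compose_left_module_hom_assoc;
      erule chain_map_left_module_hom)

lemma structure_hom_in_chain_map:
  assumes "bounded_complex X" "u \<in> center"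
  shows "(\<lambda>m. structure_hom (cterm X m) u) \<in> chain_map X X"
proof -
  have "structure_hom (cterm X (m + 1)) u (cdiff X m x) = cdiff X m (structure_hom (cterm X m) u x)"
    if "x \<in> carrier (cterm X m)" for m x
  proof -
    have "cdiff X m \<in> left_module_hom (cterm X m) (cterm X (m + 1))"
      using assms(1) by (simp add: bounded_complex_def)
    from structure_hom_commutes[OF bounded_complex_left_module[OF assms(1)] this, of u]
    have "compose (carrier (cterm X m)) (structure_hom (cterm X (m + 1)) u) (cdiff X m) x =
        compose (carrier (cterm X m)) (cdiff X m) (structure_hom (cterm X m) u) x"
      by (rule fun_cong)
    with that show ?thesis
      by (simp only: compose_eq)
  qed
  then show ?thesis
    using assms by (simp add: chain_map_def structure_hom_in_left_module_hom bounded_complex_left_module)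
qed

lemma natural_transformation_bounded_complexes:
  assumes "u \<in> center"
  shows "natural_transformation bounded_complexes bounded_complexes identity_functor identity_functor
    (\<lambda>X m. structure_hom (cterm X m) u)"
  using is_functor_identity_functor[OF is_category_bounded_complexes]
  unfolding natural_transformation_def
  by (simp add: identity_functor_def bounded_complexes_def structure_hom_in_chain_map assms
      structure_hom_commutes[OF bounded_complex_left_module chain_map_left_module_hom])

section \<open>Modules as complexes\<close>

lemma fd_left_module_zero_submodule:
  assumes "left_module M"
  shows "fd_left_module (M\<lparr>carrier := {\<zero>\<^bsub>M\<^esub>}\<rparr>)"
proof -
  interpret M: left_module M by fact
  interpret Z: abelian_group "M\<lparr>carrier := {\<zero>\<^bsub>M\<^esub>}\<rparr>"
    by (rule abelian_groupI) auto
  have "left_module (M\<lparr>carrier := {\<zero>\<^bsub>M\<^esub>}\<rparr>)"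
    by unfold_locales (auto simp: M.smult_zero)
  moreover have "finsum (M\<lparr>carrier := {\<zero>\<^bsub>M\<^esub>}\<rparr>) f {} = \<zero>\<^bsub>M\<^esub>" for f
    using Z.finsum_empty by simp
  ultimately show ?thesis
    unfolding fd_left_module_def by (auto intro!: exI[of _ "{}"])
qed

lemma bounded_complex_stalk_complex:
  assumes "fd_left_module M"
  shows "bounded_complex (stalk_complex M)"
proof -
  interpret M: left_module M
    using assms by (rule fd_left_module_imp_left_module)
  have "fd_left_module (cterm (stalk_complex M) m)" for m
    using assms fd_left_module_zero_submodule[OF M.left_module_axioms]
    by (simp add: stalk_complex_def Let_def)
  moreover have "cdiff (stalk_complex M) m \<in>
      left_module_hom (cterm (stalk_complex M) m) (cterm (stalk_complex M) (m + 1))" for m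
    by (auto simp: stalk_complex_def Let_def left_module_hom_def M.smult_zero M.smult_closed)
  moreover have "carrier (cterm (stalk_complex M) m) = {\<zero>\<^bsub>cterm (stalk_complex M) m\<^esub>}"
    if "\<bar>m\<bar> > 0" for m
    using that by (simp add: stalk_complex_def Let_def)
  ultimately show ?thesis
    unfolding bounded_complex_def
    by (auto simp: stalk_complex_def Let_def)
qed

lemma is_functor_stalk_functor:
  "is_functor (fd_modules :: (('a::fd_complex_algebra, 'm) module, 'm \<Rightarrow> 'm) category)
    bounded_complexes stalk_functor"
proof -
  have "(\<lambda>m. restrict f (carrier (cterm (stalk_complex M) m))) \<in>
      chain_map (stalk_complex M) (stalk_complex N)"
    if "left_module M" "left_module N" "f \<in> left_module_hom M N" for M N :: "('a, 'm) module" and f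
  proof -
    interpret M: left_module M by fact
    have "f \<zero>\<^bsub>M\<^esub> = \<zero>\<^bsub>N\<^esub>"
      by (rule left_module_hom_zero) fact+
    moreover have "f (a \<odot>\<^bsub>M\<^esub> \<zero>\<^bsub>M\<^esub>) = a \<odot>\<^bsub>N\<^esub> f \<zero>\<^bsub>M\<^esub>"
        "f (\<zero>\<^bsub>M\<^esub> \<oplus>\<^bsub>M\<^esub> \<zero>\<^bsub>M\<^esub>) = f \<zero>\<^bsub>M\<^esub> \<oplus>\<^bsub>N\<^esub> f \<zero>\<^bsub>M\<^esub>" for a
      using that(3) M.zero_closed unfolding left_module_hom_def by blast+
    ultimately show ?thesis
      using that(3)
      by (auto simp: chain_map_def stalk_complex_def Let_def left_module_hom_def M.smult_zero M.smult_closed)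
  qed
  moreover have "(\<lambda>m. restrict (compose (carrier L) g f) (carrier (cterm (stalk_complex L) m))) =
      (\<lambda>m. compose (carrier (cterm (stalk_complex L) m))
        (restrict g (carrier (cterm (stalk_complex M) m)))
        (restrict f (carrier (cterm (stalk_complex L) m))))"
    if "left_module L" "left_module M" "f \<in> left_module_hom L M"
    for L M :: "('a, 'm) module" and f and g :: "'m \<Rightarrow> 'm"
  proof -
    interpret L: left_module L by fact
    show ?thesis
      using left_module_hom_zero[OF that] L.zero_closed left_module_hom_mem[OF that(3)]
      by (auto simp: stalk_complex_def Let_def compose_def fun_eq_iff)
  qed
  moreover have "restrict (\<lambda>x\<in>carrier M. x) (carrier (cterm (stalk_complex M) m)) =
      (\<lambda>x\<in>carrier (cterm (stalk_complex M) m). x)" if "left_module M" for M :: "('a, 'm) module" and m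
  proof -
    interpret M: left_module M by fact
    show ?thesis by (auto simp: stalk_complex_def Let_def)
  qed
  ultimately show ?thesis
    using is_category_fd_modules is_category_bounded_complexes
    unfolding is_functor_def
    by (auto simp: stalk_functor_def fd_modules_def bounded_complexes_def
        bounded_complex_stalk_complex fd_left_module_imp_left_module)
qed

text \<open>In the degrees other than \<open>0\<close> the restriction of \<open>\<rho>\<^sub>M(u)\<close> to the zero submodule is the action of
  \<open>u\<close> there, because the stalk complex keeps the operations of \<open>M\<close> in all degrees.\<close>

lemma stalk_functor_structure_hom:
  assumes "left_module M"
  shows "fmap stalk_functor M M (structure_hom M u) = (\<lambda>m. structure_hom (cterm (stalk_complex M) m) u)"
proof -
  interpret M: left_module M by fact
  show ?thesis
    by (auto simp: stalk_functor_def structure_hom_def stalk_complex_def Let_def fun_eq_iff)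
qed

lemma is_functor_comp_functor:
  "is_functor B C F \<Longrightarrow> is_functor C D G \<Longrightarrow> is_functor B D (comp_functor G F)"
  unfolding is_functor_def comp_functor_def by simp

section \<open>Average central integrals act on modules and on the derived category\<close>

lemma algebra_iso_on_center: "algebra_iso_on center center (\<lambda>c::'a::fd_complex_algebra. c)"
  by (simp add: algebra_iso_on_def subalgebra_center bij_betw_def)

lemma natural_transformation_derived:
  assumes "u \<in> center"
  shows "natural_transformation bounded_derived bounded_derived identity_functor identity_functor
    (\<lambda>X. fmap to_derived X X (\<lambda>m. structure_hom (cterm X m) u))"
  unfolding bounded_derived_def to_derived_def
  by (rule natural_transformation_localization[OF is_category_bounded_complexes
        natural_transformation_bounded_complexes[OF assms]])

lemma lifts_along_derived_embedding:
  "lifts_along (fd_modules :: (('a::fd_complex_algebra, 'm) module, 'm \<Rightarrow> 'm) category)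
    bounded_derived derived_embedding (\<lambda>M. structure_hom M u)
    (\<lambda>X. fmap to_derived X X (\<lambda>m. structure_hom (cterm X m) u))"
proof -
  have "is_functor fd_modules bounded_derived derived_embedding"
    unfolding derived_embedding_def bounded_derived_def to_derived_def
    by (rule is_functor_comp_functor[OF is_functor_stalk_functor
          is_functor_localization_functor[OF is_category_bounded_complexes]])
  moreover have "fmap derived_embedding M M (structure_hom M u) =
      fmap to_derived (stalk_complex M) (stalk_complex M)
        (\<lambda>m. structure_hom (cterm (stalk_complex M) m) u)"
    if "fd_left_module M" for M :: "('a, 'm) module"
    using stalk_functor_structure_hom[OF fd_left_module_imp_left_module[OF that]]
    by (simp add: derived_embedding_def comp_functor_def) (simp add: stalk_functor_def)
  moreover have "fobj derived_embedding M = stalk_complex M" for M :: "('a, 'm) module"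
    by (simp add: derived_embedding_def comp_functor_def to_derived_def localization_functor_def
        stalk_functor_def)
  ultimately show ?thesis
    by (simp add: lifts_along_def fd_modules_def)
qed

theorem theorem1:
  fixes z :: "nat \<Rightarrow> 'a::fd_complex_algebra"
    and k :: nat
    and r s :: real
    and I :: "'a set"
    and \<mu> :: "'a measure"
  assumes "center_basis k z"
    and "r < s"
    and "I = cube k z r s"
    and "\<mu> = cube_measure k z r s"
  shows "algebra_iso_on center (ACI \<mu>) (\<lambda>c. (1 / measure \<mu> I) *\<^sub>R (LINT x:I|\<mu>. c))
    \<and> (\<forall>u\<in>ACI \<mu>.
        natural_transformation (fd_modules :: (('a, 'm) module, 'm \<Rightarrow> 'm) category) fd_modules
          identity_functor identity_functor (\<lambda>M. structure_hom M u))
    \<and> (\<forall>u\<in>ACI \<mu>. \<exists>\<theta> :: ('a, 'm) cochain_complex \<Rightarrow> ('a, 'm) derived_morphism.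
        natural_transformation bounded_derived bounded_derived
          identity_functor identity_functor \<theta>
        \<and> lifts_along fd_modules bounded_derived derived_embedding (\<lambda>M. structure_hom M u) \<theta>
        \<and> (\<forall>X. bounded_complex X \<longrightarrow>
              \<theta> X = fmap to_derived X X (\<lambda>m. \<lambda>x\<in>carrier (cterm X m). u \<odot>\<^bsub>cterm X m\<^esub> x)))"
proof -
  have fin: "finite_measure \<mu>"
    unfolding assms(4) using assms(1,2) by (intro finite_measure_cube) auto
  have space: "space \<mu> = I"
    using assms(3,4) by (simp add: space_cube_measure)
  have pos: "measure \<mu> (space \<mu>) > 0"
    using emeasure_cube[OF assms(1), of r s] assms(2-4) space by (simp add: measure_def)
  have ACI: "ACI \<mu> = center"
    by (rule ACI_eq_center[OF fin pos])
  have id: "(\<lambda>c. (1 / measure \<mu> I) *\<^sub>R (LINT x:I|\<mu>. c)) = (\<lambda>c::'a. c)"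
    using average_const[OF fin pos] by (simp add: average_def space)
  have derived: "\<exists>\<theta> :: ('a, 'm) cochain_complex \<Rightarrow> ('a, 'm) derived_morphism.
      natural_transformation bounded_derived bounded_derived identity_functor identity_functor \<theta>
      \<and> lifts_along fd_modules bounded_derived derived_embedding (\<lambda>M. structure_hom M u) \<theta>
      \<and> (\<forall>X. bounded_complex X \<longrightarrow>
            \<theta> X = fmap to_derived X X (\<lambda>m. structure_hom (cterm X m) u))"
    if "u \<in> center" for u
    using natural_transformation_derived[OF that] lifts_along_derived_embedding by blast
  show ?thesis
    unfolding ACI id structure_hom_def[symmetric]
    by (intro conjI ballI algebra_iso_on_center natural_transformation_structure_hom derived)
qed

end
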